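(* (i) If $\mathbf P=(P,\le,0,1)$ is a bounded poset satisfying the ACC and the DCC, then $\mathbb P(\mathbb A(\mathbf P))=\mathbf P$. (ii) If $\mathbf A=(P,\sqcup,\sqcap,0,1)$ is a finite operator structure and $\mathbb A(\mathbb P(\mathbf A))=(P,\sqcup_1,\sqcap_1,0,1)$, then $x\sqcup_1y=x\sqcup y$ and $x\sqcap_1y=x\sqcap y$ for all $x,y\in P$.
   Context: ACC/DCC: no infinite strictly ascending/descending chains. In a poset, $L(A)$, $U(A)$ denote the sets of lower/upper bounds of $A$, $\operatorname{Max}$, $\operatorname{Min}$ the sets of maximal/minimal elements, $\operatorname{Max}L(x,y)=\operatorname{Max}(L(\{x,y\}))$, $\operatorname{Min}U(x,y)=\operatorname{Min}(U(\{x,y\}))$, and for subsets $\operatorname{Min}U(A,B)=\operatorname{Min}U(A\cup B)$, $\operatorname{Max}L(A,B)=\operatorname{Max}L(A\cup B)$. A binary operator on $P$ assigns to each pair of elements (and pair of subsets) a subset of $P$; elements are identified with singletons. An operator structure is $(P,\sqcup,\sqcap,0,1)$ with binary operators $\sqcup,\sqcap$ and $0,1\in P$ such that for all $x,y,z\in P$: (i) $x\sqcup x=x$, $x\sqcap x=x$; (ii) $x\sqcup y=y\sqcup x$, $x\sqcap y=y\sqcap x$; (iii) $0\sqcup x=x$, $x\sqcap1=x$; (iv) $x\sqcup((x\sqcup y)\sqcup z)=0\sqcup((x\sqcup y)\sqcup z)$ and $x\sqcap((x\sqcap y)\sqcap z)=((x\sqcap y)\sqcap z)\sqcap1$; (v)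 $(x\sqcap y)\sqcup y=y$, $x\sqcap(x\sqcup y)=x$; (vi) $z\in x\sqcup y$ iff [$x\sqcup z=y\sqcup z=z$ and every $u\in P$ with $x\sqcup u=y\sqcup u=u\sqcap z=u$ satisfies $u=z$], and $z\in x\sqcap y$ iff [$z\sqcap x=z\sqcap y=z$ and every $u\in P$ with $u\sqcap x=u\sqcap y=z\sqcup u=u$ satisfies $u=z$]. For a bounded poset $\mathbf P=(P,\le,0,1)$ with ACC and DCC, $\mathbb A(\mathbf P):=(P,\operatorname{Min}U,\operatorname{Max}L,0,1)$ (an operator structure). For an operator structure $\mathbf A=(P,\sqcup,\sqcap,0,1)$, $\mathbb P(\mathbf A):=(P,\le,0,1)$ where $x\le y$ iff $x\sqcup y=y$ (a bounded poset). *)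

theory Defs
  imports Main
begin

record 'a bounded_carrier =
  carrier :: "'a set"
  zero :: 'a
  one :: 'a

record 'a bounded_order = "'a bounded_carrier" +
  le :: "'a rel"

text \<open>The operators take and return subsets of the carrier: an element \<open>x\<close> is identified with the
  singleton \<open>{x}\<close>, so \<open>x \<squnion> y\<close> is written \<open>{x} \<squnion> {y}\<close> and an equation such as
  \<open>x \<squnion> y = y\<close> becomes \<open>{x} \<squnion> {y} = {y}\<close>.\<close>

record 'a operator_algebra = "'a bounded_carrier" +
  join :: "'a set \<Rightarrow> 'a set \<Rightarrow> 'a set" (infixl "\<squnion>\<index>" 65)
  meet :: "'a set \<Rightarrow> 'a set \<Rightarrow> 'a set" (infixl "\<sqinter>\<index>" 70)

locale bounded_poset =
  fixes P :: "'a bounded_order"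
  assumes partial_order: "partial_order_on (carrier P) (le P)"
    and zero_closed: "zero P \<in> carrier P"
    and one_closed: "one P \<in> carrier P"
    and zero_least: "x \<in> carrier P \<Longrightarrow> (zero P, x) \<in> le P"
    and one_greatest: "x \<in> carrier P \<Longrightarrow> (x, one P) \<in> le P"

definition ACC :: "'a bounded_order \<Rightarrow> bool" where
  "ACC P \<longleftrightarrow>
    \<not> (\<exists>f :: nat \<Rightarrow> 'a. \<forall>n. f n \<in> carrier P \<and> (f n, f (Suc n)) \<in> le P \<and> f n \<noteq> f (Suc n))"

definition DCC :: "'a bounded_order \<Rightarrow> bool" where
  "DCC P \<longleftrightarrow>
    \<not> (\<exists>f :: nat \<Rightarrow> 'a. \<forall>n. f n \<in> carrier P \<and> (f (Suc n), f n) \<in> le P \<and> f (Suc n) \<noteq> f n)"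

definition lower_bounds :: "'a bounded_order \<Rightarrow> 'a set \<Rightarrow> 'a set" where
  "lower_bounds P A = {l \<in> carrier P. \<forall>a\<in>A. (l, a) \<in> le P}"

definition upper_bounds :: "'a bounded_order \<Rightarrow> 'a set \<Rightarrow> 'a set" where
  "upper_bounds P A = {u \<in> carrier P. \<forall>a\<in>A. (a, u) \<in> le P}"

definition maximal_elements :: "'a bounded_order \<Rightarrow> 'a set \<Rightarrow> 'a set" where
  "maximal_elements P A = {m \<in> A. \<forall>a\<in>A. (m, a) \<in> le P \<longrightarrow> a = m}"

definition minimal_elements :: "'a bounded_order \<Rightarrow> 'a set \<Rightarrow> 'a set" where
  "minimal_elements P A = {m \<in> A. \<forall>a\<in>A. (a, m) \<in> le P \<longrightarrow> a = m}"

definition MinU :: "'a bounded_order \<Rightarrow> 'a set \<Rightarrow> 'a set \<Rightarrow> 'a set" where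
  "MinU P A B = minimal_elements P (upper_bounds P (A \<union> B))"

definition MaxL :: "'a bounded_order \<Rightarrow> 'a set \<Rightarrow> 'a set \<Rightarrow> 'a set" where
  "MaxL P A B = maximal_elements P (lower_bounds P (A \<union> B))"

locale operator_structure =
  fixes S :: "'a operator_algebra" (structure)
  assumes join_closed: "\<lbrakk>A \<subseteq> carrier S; B \<subseteq> carrier S\<rbrakk> \<Longrightarrow> A \<squnion> B \<subseteq> carrier S"
    and meet_closed: "\<lbrakk>A \<subseteq> carrier S; B \<subseteq> carrier S\<rbrakk> \<Longrightarrow> A \<sqinter> B \<subseteq> carrier S"
    and zero_closed: "zero S \<in> carrier S"
    and one_closed: "one S \<in> carrier S"
    and join_idem: "x \<in> carrier S \<Longrightarrow> {x} \<squnion> {x} = {x}"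
    and meet_idem: "x \<in> carrier S \<Longrightarrow> {x} \<sqinter> {x} = {x}"
    and join_comm: "\<lbrakk>x \<in> carrier S; y \<in> carrier S\<rbrakk> \<Longrightarrow> {x} \<squnion> {y} = {y} \<squnion> {x}"
    and meet_comm: "\<lbrakk>x \<in> carrier S; y \<in> carrier S\<rbrakk> \<Longrightarrow> {x} \<sqinter> {y} = {y} \<sqinter> {x}"
    and zero_join: "x \<in> carrier S \<Longrightarrow> {zero S} \<squnion> {x} = {x}"
    and meet_one: "x \<in> carrier S \<Longrightarrow> {x} \<sqinter> {one S} = {x}"
    and join_weak_assoc: "\<lbrakk>x \<in> carrier S; y \<in> carrier S; z \<in> carrier S\<rbrakk> \<Longrightarrow>
      {x} \<squnion> (({x} \<squnion> {y}) \<squnion> {z}) = {zero S} \<squnion> (({x} \<squnion> {y}) \<squnion> {z})"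
    and meet_weak_assoc: "\<lbrakk>x \<in> carrier S; y \<in> carrier S; z \<in> carrier S\<rbrakk> \<Longrightarrow>
      {x} \<sqinter> (({x} \<sqinter> {y}) \<sqinter> {z}) = (({x} \<sqinter> {y}) \<sqinter> {z}) \<sqinter> {one S}"
    and join_absorb: "\<lbrakk>x \<in> carrier S; y \<in> carrier S\<rbrakk> \<Longrightarrow> ({x} \<sqinter> {y}) \<squnion> {y} = {y}"
    and meet_absorb: "\<lbrakk>x \<in> carrier S; y \<in> carrier S\<rbrakk> \<Longrightarrow> {x} \<sqinter> ({x} \<squnion> {y}) = {x}"
    and in_join_iff: "\<lbrakk>x \<in> carrier S; y \<in> carrier S; z \<in> carrier S\<rbrakk> \<Longrightarrow>
      z \<in> {x} \<squnion> {y} \<longleftrightarrow>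
        {x} \<squnion> {z} = {z} \<and> {y} \<squnion> {z} = {z} \<and>
        (\<forall>u\<in>carrier S. {x} \<squnion> {u} = {u} \<and> {y} \<squnion> {u} = {u} \<and> {u} \<sqinter> {z} = {u} \<longrightarrow> u = z)"
    and in_meet_iff: "\<lbrakk>x \<in> carrier S; y \<in> carrier S; z \<in> carrier S\<rbrakk> \<Longrightarrow>
      z \<in> {x} \<sqinter> {y} \<longleftrightarrow>
        {z} \<sqinter> {x} = {z} \<and> {z} \<sqinter> {y} = {z} \<and>
        (\<forall>u\<in>carrier S. {u} \<sqinter> {x} = {u} \<and> {u} \<sqinter> {y} = {u} \<and> {z} \<squnion> {u} = {u} \<longrightarrow> u = z)"

definition operator_algebra_of :: "'a bounded_order \<Rightarrow> 'a operator_algebra" ("\<bbbA>") where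
  "\<bbbA> P = \<lparr>carrier = carrier P, zero = zero P, one = one P, join = MinU P, meet = MaxL P\<rparr>"

definition bounded_order_of :: "'a operator_algebra \<Rightarrow> 'a bounded_order" ("\<bbbP>") where
  "\<bbbP> S = \<lparr>carrier = carrier S, zero = zero S, one = one S,
    le = {(x, y). x \<in> carrier S \<and> y \<in> carrier S \<and> join S {x} {y} = {y}}\<rparr>"

end

theory Submission
  imports Defs
begin

text \<open>Both round trips rest on reading \<open>x \<le> y\<close> as
  \<open>{x} \<squnion> {y} = {y}\<close>. For a poset, y is the only minimal upper bound of x and y
  exactly when x lies below y, so the order is recovered from \<open>MinU\<close>
  (\<open>MinU_eq_upper_iff_le\<close>). For an operator structure, absorption makes the join and
  meet descriptions of the order agree (\<open>join_eq_right_iff_meet_eq_left\<close>). The axioms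
  \<open>in_join_iff\<close> and \<open>in_meet_iff\<close> then say precisely that the members of a
  join are the minimal upper bounds and those of a meet the maximal lower bounds.\<close>

lemma join_operator_algebra_of: "join (\<bbbA> P) = MinU P"
  and meet_operator_algebra_of: "meet (\<bbbA> P) = MaxL P"
  by (simp_all add: operator_algebra_of_def)

context bounded_poset
begin

text \<open>If x lies below y, then y is itself an upper bound and lies below every other one, so it
  is the only minimal one. Conversely, membership of y in \<open>MinU\<close> already makes it an
  upper bound of x.\<close>

lemma MinU_eq_upper_iff_le:
  assumes x: "x \<in> carrier P" and y: "y \<in> carrier P"
  shows "MinU P {x} {y} = {y} \<longleftrightarrow> (x, y) \<in> le P"
proof -
  have "refl_on (carrier P) (le P)" and "antisym (le P)"
    using partial_order by (simp_all add: partial_order_on_def preorder_on_def)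
  with y show ?thesis
    by (auto simp: MinU_def minimal_elements_def upper_bounds_def dest: refl_onD antisymD)
qed

lemma bounded_order_of_operator_algebra_of: "\<bbbP> (\<bbbA> P) = P"
proof -
  \<comment> \<open>\<open>\<bbbP>\<close> keeps only pairs from the carrier, so equality of
    relations needs \<open>le P\<close> to contain no others.\<close>
  have "le P \<subseteq> carrier P \<times> carrier P"
    using partial_order by (simp add: partial_order_on_def preorder_on_def)
  then have "{(x, y). x \<in> carrier P \<and> y \<in> carrier P \<and> MinU P {x} {y} = {y}} = le P"
    using MinU_eq_upper_iff_le by auto
  then show ?thesis
    by (simp add: bounded_order_of_def operator_algebra_of_def)
qed

end

context operator_structure
begin

text \<open>Substituting either equation into the absorption law for the other operator yields the
  other equation.\<close>

lemma join_eq_right_iff_meet_eq_left: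
  assumes "x \<in> carrier S" and "y \<in> carrier S"
  shows "{x} \<squnion> {y} = {y} \<longleftrightarrow> {x} \<sqinter> {y} = {x}"
  using join_absorb[OF assms] meet_absorb[OF assms] by auto

lemma MinU_bounded_order_of:
  assumes x: "x \<in> carrier S" and y: "y \<in> carrier S"
  shows "MinU (\<bbbP> S) {x} {y} = {x} \<squnion> {y}"
proof (rule set_eqI)
  fix z
  show "z \<in> MinU (\<bbbP> S) {x} {y} \<longleftrightarrow> z \<in> {x} \<squnion> {y}"
  proof (cases "z \<in> carrier S")
    case True
    then show ?thesis
      \<comment> \<open>The axiom states the bounds through joins but minimality through
        \<open>{u} \<sqinter> {z} = {u}\<close>; the equivalence above turns both into the one order
        of \<open>\<bbbP> S\<close>.\<close>
      using x y unfolding in_join_iff[OF x y True]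
      by (auto simp: MinU_def minimal_elements_def upper_bounds_def bounded_order_of_def
          join_eq_right_iff_meet_eq_left)
  next
    case False
    then show ?thesis
      \<comment> \<open>The axiom is silent about z outside the carrier; closure excludes such z
        from the join.\<close>
      using join_closed[of "{x}" "{y}"] x y
      by (auto simp: MinU_def minimal_elements_def upper_bounds_def bounded_order_of_def)
  qed
qed

lemma MaxL_bounded_order_of:
  assumes x: "x \<in> carrier S" and y: "y \<in> carrier S"
  shows "MaxL (\<bbbP> S) {x} {y} = {x} \<sqinter> {y}"
proof (rule set_eqI)
  fix z
  show "z \<in> MaxL (\<bbbP> S) {x} {y} \<longleftrightarrow> z \<in> {x} \<sqinter> {y}"
  proof (cases "z \<in> carrier S")
    case True
    then show ?thesis
      \<comment> \<open>Here the bounds are stated through meets and maximality through a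
        join.\<close>
      using x y unfolding in_meet_iff[OF x y True]
      by (auto simp: MaxL_def maximal_elements_def lower_bounds_def bounded_order_of_def
          join_eq_right_iff_meet_eq_left)
  next
    case False
    then show ?thesis
      using meet_closed[of "{x}" "{y}"] x y
      by (auto simp: MaxL_def maximal_elements_def lower_bounds_def bounded_order_of_def)
  qed
qed

end

theorem theorem3p4:
  fixes P :: "'a bounded_order" and S :: "'b operator_algebra"
  shows "(bounded_poset P \<and> ACC P \<and> DCC P \<longrightarrow> \<bbbP> (\<bbbA> P) = P) \<and>
    (operator_structure S \<and> finite (carrier S) \<longrightarrow>
      (\<forall>x\<in>carrier S. \<forall>y\<in>carrier S.
        join (\<bbbA> (\<bbbP> S)) {x} {y} = join S {x} {y} \<and>
        meet (\<bbbA> (\<bbbP> S)) {x} {y} = meet S {x} {y}))"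
  by (simp add: bounded_poset.bounded_order_of_operator_algebra_of
      join_operator_algebra_of meet_operator_algebra_of
      operator_structure.MinU_bounded_order_of operator_structure.MaxL_bounded_order_of)

end
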